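(* Let $r\geq 2$, $1\leq \ell\leq r$, and for $n\geq\binom{r}{\ell}$ let $(V_1^{(n)},\ldots,V_r^{(n)})$ be uniformly distributed on $H_{\ell,r}(n)$. Let $f:\mathbb{N}\to\mathbb{C}$ be an arbitrary arithmetic function. Then \[ f({\rm GCD}(V_1^{(n)},\ldots,V_r^{(n)}))\overset{{\rm d}}{\underset{n\to\infty}\longrightarrow} f\Big(\prod_{p\in\mathcal{P}}p^{\min_{k=1,\ldots,r}\mathcal{G}_k(p)}\Big). \]
   Context: $P_\ell(x_1,\ldots,x_r)=\sum_{1\leq i_1<\cdots<i_\ell\leq r}x_{i_1}\cdots x_{i_\ell}$; $H_{\ell,r}(n)=\{(i_1,\ldots,i_r)\in\mathbb{N}^r: P_\ell(i_1,\ldots,i_r)\leq n\}$, $\mathbb{N}=\{1,2,\ldots\}$. $\mathcal{P}$ is the set of primes, and $(\mathcal{G}_k(p))_{k\in\mathbb{N},p\in\mathcal{P}}$ are mutually independent random variables with $\mathbb{P}\{\mathcal{G}_k(p)=j\}=(1-1/p)p^{-j}$, $j=0,1,2,\ldots$ (the infinite product in the limit converges almost surely). *)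

theory Defs
  imports "HOL-Probability.Probability"
begin

definition esym :: "nat \<Rightarrow> nat \<Rightarrow> (nat \<Rightarrow> nat) \<Rightarrow> nat" where
  "esym l r x = (\<Sum>I | I \<subseteq> {1..r} \<and> card I = l. \<Prod>i\<in>I. x i)"

definition hyperbolic_region :: "nat \<Rightarrow> nat \<Rightarrow> nat \<Rightarrow> (nat \<Rightarrow> nat) set" where
  "hyperbolic_region l r n = {x \<in> {1..r} \<rightarrow>\<^sub>E {1..}. esym l r x \<le> n}"

text \<open>
  The library's \<^const>\<open>weak_conv_m\<close> only covers real-valued variables. The variables may live on
  different probability spaces, and only the tail of the sequence matters, so measurability
  is required eventually; without it the Bochner integrals would silently be 0.
\<close>

definition converges_in_distribution ::
  "(nat \<Rightarrow> 'a measure) \<Rightarrow> (nat \<Rightarrow> 'a \<Rightarrow> 'c::metric_space) \<Rightarrow> 'b measure \<Rightarrow> ('b \<Rightarrow> 'c) \<Rightarrow> bool" where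
  "converges_in_distribution N X M Y \<longleftrightarrow>
     (\<forall>\<^sub>F n in sequentially. X n \<in> borel_measurable (N n)) \<and>
     Y \<in> borel_measurable M \<and>
     (\<forall>g :: 'c \<Rightarrow> real. continuous_on UNIV g \<and> bounded (range g) \<longrightarrow>
        (\<lambda>n. \<integral>\<omega>. g (X n \<omega>) \<partial>N n) \<longlonglongrightarrow> (\<integral>\<omega>. g (Y \<omega>) \<partial>M))"

end

theory Submission
  imports Defs "HOL-Computational_Algebra.Squarefree"
begin

text \<open>
  Write \<open>X\<^sub>n\<close> for the gcd and \<open>Y\<close> for its limit. It suffices that \<open>P(d | X\<^sub>n) \<rightarrow> P(d | Y)\<close> for every \<open>d\<close> and
  that \<open>P(d | X\<^sub>n) \<le> d\<^bsup>-r\<^esup>\<close>: since these bounds are summable, the laws of \<open>gcd(X\<^sub>n, K!)\<close>, which converge for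
  each \<open>K\<close>, approximate those of \<open>X\<^sub>n\<close> uniformly in \<open>n\<close>. Independence gives \<open>P(d | Y) = d\<^bsup>-r\<^esup>\<close>.

  In any finite down-closed set \<open>H\<close> of positive lattice points, rounding all coordinates to multiples
  of \<open>d\<close> shows that the proportion of points divisible by \<open>d\<close> is \<open>d\<^bsup>-r\<^esup>\<close> up to the proportion of points
  with a coordinate below \<open>d\<close>, so it suffices that the slice \<open>x\<^sub>i = 1\<close> is negligible. For the
  hyperbolic regions no asymptotics of \<open>|H|\<close> are needed: up to a bounded number of points, the slice
  \<open>x\<^sub>i = c\<close> has at least \<open>1/(rc)\<close> times as many points as the slice \<open>x\<^sub>i = 1\<close>, and the harmonic
  series diverges.
\<close>

subsection \<open>Elementary symmetric polynomials\<close>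

definition elem_sym :: "nat \<Rightarrow> 'i set \<Rightarrow> ('i \<Rightarrow> 'a::comm_semiring_1) \<Rightarrow> 'a" where
  "elem_sym l A x = (\<Sum>I | I \<subseteq> A \<and> card I = l. \<Prod>i\<in>I. x i)"

lemma esym_eq_elem_sym: "esym l r = elem_sym l {1..r}"
  by (simp add: fun_eq_iff esym_def elem_sym_def)

lemma elem_sym_cong:
  assumes "\<And>i. i \<in> A \<Longrightarrow> x i = y i"
  shows "elem_sym l A x = elem_sym l A y"
  unfolding elem_sym_def using assms by (intro sum.cong prod.cong) auto

lemma elem_sym_0:
  assumes "finite A"
  shows "elem_sym 0 A x = 1"
proof -
  have "{I. I \<subseteq> A \<and> card I = 0} = {{}}"
    using assms by (auto dest: finite_subset)
  then show ?thesis by (simp add: elem_sym_def)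
qed

lemma elem_sym_Suc_insert:
  assumes "finite A" and "a \<notin> A"
  shows "elem_sym (Suc l) (insert a A) x = elem_sym (Suc l) A x + x a * elem_sym l A x"
proof -
  define P where "P m = {I. I \<subseteq> A \<and> card I = m}" for m
  have memberD: "finite I" "a \<notin> I" if "I \<in> P m" for I m
    using that assms by (auto simp: P_def dest: finite_subset)
  have "{I. I \<subseteq> insert a A \<and> card I = Suc l} = P (Suc l) \<union> insert a ` P l"
  proof (intro subset_antisym subsetI)
    fix I assume I_in: "I \<in> {I. I \<subseteq> insert a A \<and> card I = Suc l}"
    show "I \<in> P (Suc l) \<union> insert a ` P l"
    proof (cases "a \<in> I")
      case True
      then have "I = insert a (I - {a})" "I - {a} \<in> P l"
        using I_in by (auto simp: P_def)
      then show ?thesis by blast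
    qed (use I_in in \<open>auto simp: P_def\<close>)
  qed (use assms in \<open>auto simp: P_def card_insert_if finite_subset[of _ A]\<close>)
  moreover have "finite (P m)" for m
    using assms by (simp add: P_def)
  moreover have "P (Suc l) \<inter> insert a ` P l = {}"
    using memberD by blast
  moreover have "inj_on (insert a) (P l)"
    using memberD by (meson inj_onI insert_ident)
  ultimately have "elem_sym (Suc l) (insert a A) x = elem_sym (Suc l) A x + (\<Sum>I\<in>P l. \<Prod>i\<in>insert a I. x i)"
    by (simp add: elem_sym_def sum.union_disjoint sum.reindex flip: P_def)
  also have "(\<Sum>I\<in>P l. \<Prod>i\<in>insert a I. x i) = x a * elem_sym l A x"
    using memberD by (simp add: elem_sym_def sum_distrib_left flip: P_def)
  finally show ?thesis .
qed

lemma elem_sym_nonneg: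
  fixes x :: "'i \<Rightarrow> 'a::linordered_semidom"
  assumes "\<And>i. i \<in> A \<Longrightarrow> 0 \<le> x i"
  shows "0 \<le> elem_sym l A x"
  unfolding elem_sym_def using assms by (intro sum_nonneg prod_nonneg) auto

lemma elem_sym_mono:
  fixes x y :: "'i \<Rightarrow> 'a::linordered_semidom"
  assumes "\<And>i. i \<in> A \<Longrightarrow> 0 \<le> x i" and "\<And>i. i \<in> A \<Longrightarrow> x i \<le> y i"
  shows "elem_sym l A x \<le> elem_sym l A y"
  unfolding elem_sym_def using assms by (intro sum_mono prod_mono) auto

lemma elem_sym_mono_sum_prod:
  fixes x y :: "'i \<Rightarrow> 'a::linordered_semidom"
  assumes "finite A" and members: "i \<in> A" "j \<in> A" "i \<noteq> j"
    and nonneg: "\<And>k. k \<in> A - {i, j} \<Longrightarrow> 0 \<le> x k"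
    and agree: "\<And>k. k \<in> A - {i, j} \<Longrightarrow> x k = y k"
    and sum_le: "x i + x j \<le> y i + y j" and prod_le: "x i * x j \<le> y i * y j"
  shows "elem_sym l A x \<le> elem_sym l A y"
proof -
  define B where "B = A - {i, j}"
  have insert: "A = insert i (insert j B)" and complement: "finite B" "i \<notin> insert j B" "j \<notin> B"
    using assms(1) members by (auto simp: B_def)
  have elem_sym_eq: "elem_sym m B y = elem_sym m B x" for m
    by (rule elem_sym_cong) (simp add: agree B_def)
  have elem_sym_ge_0: "0 \<le> elem_sym m B x" for m
    by (rule elem_sym_nonneg) (simp add: nonneg B_def)
  consider (zero) "l = 0" | (one) "l = 1" | (at_least_two) m where "l = Suc (Suc m)"
    by (metis One_nat_def not0_implies_Suc)
  then show ?thesis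
  proof cases
    case zero
    then show ?thesis using assms(1) by (simp add: elem_sym_0)
  next
    case one
    then have "elem_sym l A z = elem_sym 1 B z + (z i + z j)" for z :: "'i \<Rightarrow> 'a"
      unfolding insert using complement by (simp add: elem_sym_Suc_insert elem_sym_0 algebra_simps)
    then show ?thesis using sum_le by (simp add: elem_sym_eq)
  next
    case at_least_two
    then have "elem_sym l A z = elem_sym (Suc (Suc m)) B z + (z i + z j) * elem_sym (Suc m) B z
        + z i * z j * elem_sym m B z" for z :: "'i \<Rightarrow> 'a"
      unfolding insert using complement by (simp add: elem_sym_Suc_insert algebra_simps)
    then show ?thesis
      using sum_le prod_le by (simp add: elem_sym_eq elem_sym_ge_0 add_mono mult_right_mono)
  qed
qed

lemma member_le_elem_sym:
  fixes x :: "'i \<Rightarrow> 'a::linordered_semidom"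
  assumes "finite A" and degree: "1 \<le> l" "l \<le> card A" and member: "i \<in> A"
    and ge_1: "\<And>k. k \<in> A \<Longrightarrow> 1 \<le> x k"
  shows "x i \<le> elem_sym l A x"
proof -
  have nonneg: "0 \<le> x k" if "k \<in> A" for k
    using ge_1[OF that] by (rule order_trans[OF zero_le_one])
  have "l - 1 \<le> card (A - {i})" using assms(1) degree member by simp
  then obtain J where rest: "J \<subseteq> A - {i}" "card J = l - 1" "finite J"
    by (rule obtain_subset_with_card_n)
  have "x i * 1 \<le> x i * (\<Prod>k\<in>J. x k)"
    using rest nonneg[OF member] ge_1 by (intro mult_left_mono prod_ge_1) auto
  also have "\<dots> = (\<Prod>k\<in>insert i J. x k)"
    using rest by (subst prod.insert) auto
  also have "\<dots> \<le> elem_sym l A x"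
    unfolding elem_sym_def
  proof (rule member_le_sum)
    show "insert i J \<in> {I. I \<subseteq> A \<and> card I = l}"
      using rest degree member by (auto simp: card_insert_if)
  qed (use assms(1) nonneg in \<open>auto intro!: prod_nonneg\<close>)
  finally show ?thesis by simp
qed

subsection \<open>Divisibility in finite down-closed sets of lattice points\<close>

definition multiples :: "nat \<Rightarrow> 'i set \<Rightarrow> ('i \<Rightarrow> nat) set \<Rightarrow> ('i \<Rightarrow> nat) set" where
  "multiples d I H = {x \<in> H. \<forall>k\<in>I. d dvd x k}"

definition slice :: "'i \<Rightarrow> nat \<Rightarrow> ('i \<Rightarrow> nat) set \<Rightarrow> ('i \<Rightarrow> nat) set" where
  "slice i c H = {x \<in> H. x i = c}"

definition proportion :: "'a set \<Rightarrow> 'a set \<Rightarrow> real" where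
  "proportion A H = real (card A) / real (card H)"

lemma minus_eq_minus_of_dvd:
  fixes x y a b d :: nat
  assumes "d dvd x" "d dvd y" and residues: "a < d" "b < d" and "a \<le> x" "b \<le> y" and "x - a = y - b"
  shows "x = y \<and> a = b"
proof -
  have sum: "x + b = y + a" using assms by linarith
  moreover have "b mod d = (x + b) mod d" "a mod d = (y + a) mod d"
    using assms(1,2) by (auto elim!: dvdE)
  ultimately have "a = b" using residues by (metis mod_less)
  with sum show ?thesis by simp
qed

locale finite_down_set =
  fixes I :: "'i set" and H :: "('i \<Rightarrow> nat) set"
  assumes finite_index: "finite I" and finite_points: "finite H" and subset_PiE: "H \<subseteq> I \<rightarrow>\<^sub>E {1..}"
    and down_closed: "\<lbrakk>x \<in> H; y \<in> I \<rightarrow>\<^sub>E {1..}; \<And>k. k \<in> I \<Longrightarrow> y k \<le> x k\<rbrakk> \<Longrightarrow> y \<in> H"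
begin

lemma coordinate_ge_1: "x \<in> H \<Longrightarrow> k \<in> I \<Longrightarrow> 1 \<le> x k"
  using subset_PiE by auto

lemma points_eqI: "\<lbrakk>x \<in> H; y \<in> H; \<And>k. k \<in> I \<Longrightarrow> x k = y k\<rbrakk> \<Longrightarrow> x = y"
  using subset_PiE by (intro PiE_ext[of x I "\<lambda>_. {1..}" y]) auto

lemma finite_multiples: "finite (multiples d I H)"
  and finite_slice: "finite (slice i c H)"
  using finite_points by (simp_all add: multiples_def slice_def)

lemma card_multiples_le: "d ^ card I * card (multiples d I H) \<le> card H"
proof -
  let ?R = "I \<rightarrow>\<^sub>E {..<d}"
  define sub where "sub = (\<lambda>(x, a). \<lambda>k\<in>I. x k - a k :: nat)"
  have less: "a k < x k" if "x \<in> multiples d I H" "a \<in> ?R" "k \<in> I" for x a k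
  proof -
    have "a k < d" using that by auto
    also have "d \<le> x k"
      using that coordinate_ge_1[of x k] by (intro dvd_imp_le) (auto simp: multiples_def)
    finally show ?thesis .
  qed
  have "card (multiples d I H \<times> ?R) \<le> card H"
  proof (rule card_inj_on_le[OF _ _ finite_points])
    show "inj_on sub (multiples d I H \<times> ?R)"
    proof (rule inj_onI, clarify)
      fix x a y b
      assume x_in: "x \<in> multiples d I H" and a_in: "a \<in> ?R" and y_in: "y \<in> multiples d I H" and b_in: "b \<in> ?R"
        and sub_eq: "sub (x, a) = sub (y, b)"
      have coordinates: "x k = y k \<and> a k = b k" if "k \<in> I" for k
      proof (rule minus_eq_minus_of_dvd)
        show "d dvd x k" "d dvd y k" using x_in y_in that by (auto simp: multiples_def)
        show "a k < d" "b k < d" using a_in b_in that by auto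
        show "a k \<le> x k" "b k \<le> y k"
          using less[OF x_in a_in that] less[OF y_in b_in that] by simp_all
        show "x k - a k = y k - b k" using fun_cong[OF sub_eq, of k] that by (simp add: sub_def)
      qed
      have "x = y" by (rule points_eqI) (use x_in y_in coordinates in \<open>auto simp: multiples_def\<close>)
      moreover have "a = b" by (rule PiE_ext[OF a_in b_in]) (use coordinates in auto)
      ultimately show "x = y \<and> a = b" by simp
    qed
    show "sub ` (multiples d I H \<times> ?R) \<subseteq> H"
    proof clarify
      fix x a assume x_in: "x \<in> multiples d I H" and a_in: "a \<in> ?R"
      show "sub (x, a) \<in> H"
        by (rule down_closed[of x]) (use x_in less[OF x_in a_in] in \<open>auto simp: multiples_def sub_def Suc_le_eq\<close>)
    qed
  qed
  then show ?thesis
    using finite_index by (simp add: card_cartesian_product card_funcsetE mult.commute)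
qed

lemma card_all_ge_le_multiples:
  assumes "0 < d"
  shows "card {x \<in> H. \<forall>k\<in>I. d \<le> x k} \<le> d ^ card I * card (multiples d I H)"
proof -
  let ?R = "I \<rightarrow>\<^sub>E {..<d}"
  define divmod where "divmod x = ((\<lambda>k\<in>I. x k mod d), (\<lambda>k\<in>I. d * (x k div d)))" for x
  have "card {x \<in> H. \<forall>k\<in>I. d \<le> x k} \<le> card (?R \<times> multiples d I H)"
  proof (rule card_inj_on_le)
    show "inj_on divmod {x \<in> H. \<forall>k\<in>I. d \<le> x k}"
    proof (rule inj_onI)
      fix x y assume x_in: "x \<in> {x \<in> H. \<forall>k\<in>I. d \<le> x k}" and y_in: "y \<in> {x \<in> H. \<forall>k\<in>I. d \<le> x k}"
        and divmod_eq: "divmod x = divmod y"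
      have "x k = y k" if "k \<in> I" for k
      proof -
        have "x k mod d = y k mod d" "d * (x k div d) = d * (y k div d)"
          using divmod_eq that unfolding divmod_def by (auto dest!: fun_cong[where x = k])
        then show ?thesis by (metis mult_div_mod_eq)
      qed
      with x_in y_in show "x = y" by (intro points_eqI) auto
    qed
    show "divmod ` {x \<in> H. \<forall>k\<in>I. d \<le> x k} \<subseteq> ?R \<times> multiples d I H"
    proof (intro image_subsetI)
      fix x assume x_in: "x \<in> {x \<in> H. \<forall>k\<in>I. d \<le> x k}"
      have "(\<lambda>k\<in>I. d * (x k div d)) \<in> H"
      proof (rule down_closed)
        show "x \<in> H" using x_in by simp
        show "(\<lambda>k\<in>I. d * (x k div d)) \<in> I \<rightarrow>\<^sub>E {1..}"
          using x_in assms by (auto simp: Suc_le_eq div_greater_zero_iff)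
      qed simp
      then show "divmod x \<in> ?R \<times> multiples d I H"
        using assms by (auto simp: divmod_def multiples_def)
    qed
  qed (simp add: finite_index finite_multiples finite_PiE)
  then show ?thesis
    using finite_index by (simp add: card_cartesian_product card_funcsetE)
qed

lemma card_slice_le_slice_one:
  assumes "i \<in> I"
  shows "card (slice i c H) \<le> card (slice i 1 H)"
proof (rule card_inj_on_le[OF _ _ finite_slice])
  show "inj_on (\<lambda>x. x(i := 1)) (slice i c H)"
    by (rule inj_on_inverseI[of _ "\<lambda>x. x(i := c)"]) (auto simp: slice_def)
  have "x(i := 1) \<in> H" if "x \<in> H" for x
  proof (rule down_closed[OF that])
    show "x(i := 1) \<in> I \<rightarrow>\<^sub>E {1..}"
      using that assms subset_PiE by (force simp: PiE_iff extensional_def)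
    show "(x(i := 1)) k \<le> x k" if "k \<in> I" for k
      using coordinate_ge_1[OF \<open>x \<in> H\<close> that] by (cases "k = i") simp_all
  qed
  then show "(\<lambda>x. x(i := 1)) ` slice i c H \<subseteq> slice i 1 H"
    by (auto simp: slice_def)
qed

lemma card_le_multiples_plus_slices:
  assumes "0 < d"
  shows "card H \<le> d ^ card I * card (multiples d I H) + d * (\<Sum>i\<in>I. card (slice i 1 H))"
proof -
  let ?small = "\<Union>i\<in>I. \<Union>c\<in>{..<d}. slice i c H"
  have "{x \<in> H. \<forall>k\<in>I. d \<le> x k} \<union> ?small = H"
    by (auto simp: slice_def not_le)
  then have "card H \<le> card {x \<in> H. \<forall>k\<in>I. d \<le> x k} + card ?small"
    using card_Un_le[of "{x \<in> H. \<forall>k\<in>I. d \<le> x k}" ?small] by simp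
  also have "card ?small \<le> (\<Sum>i\<in>I. \<Sum>c<d. card (slice i c H))"
    by (intro order_trans[OF card_UN_le] sum_mono card_UN_le finite_index finite_lessThan)
  also have "\<dots> \<le> (\<Sum>i\<in>I. \<Sum>c<d. card (slice i 1 H))"
    by (intro sum_mono card_slice_le_slice_one)
  also have "\<dots> = d * (\<Sum>i\<in>I. card (slice i 1 H))"
    by (simp add: sum_distrib_left)
  finally show ?thesis using card_all_ge_le_multiples[OF assms] by linarith
qed

lemma proportion_multiples_le:
  assumes "0 < d"
  shows "proportion (multiples d I H) H \<le> 1 / real d ^ card I"
proof (cases "card H = 0")
  case False
  have "real d ^ card I * real (card (multiples d I H)) \<le> real (card H)"
    using card_multiples_le[of d] by (metis of_nat_le_iff of_nat_mult of_nat_power)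
  then show ?thesis using False assms by (simp add: proportion_def field_simps)
qed (simp add: proportion_def)

lemma proportion_multiples_ge:
  assumes "0 < d" and "H \<noteq> {}"
  shows "1 / real d ^ card I * (1 - d * (\<Sum>i\<in>I. proportion (slice i 1 H) H))
           \<le> proportion (multiples d I H) H"
proof -
  have card_pos: "0 < card H" using assms finite_points by (simp add: card_gt_0_iff)
  have "real (card H) \<le> real d ^ card I * real (card (multiples d I H)) + d * (\<Sum>i\<in>I. real (card (slice i 1 H)))"
    using card_le_multiples_plus_slices[of d, THEN of_nat_mono[where 'a = real]] assms by simp
  then have "real (card H) * (1 - d * (\<Sum>i\<in>I. proportion (slice i 1 H) H))
      \<le> real d ^ card I * real (card (multiples d I H))"
    using card_pos by (simp add: proportion_def sum_divide_distrib[symmetric] right_diff_distrib)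
  then show ?thesis using card_pos assms by (simp add: proportion_def field_simps)
qed

end

lemma tendsto_proportion_multiples:
  fixes H :: "'n \<Rightarrow> ('i \<Rightarrow> nat) set"
  assumes down: "\<And>n. finite_down_set I (H n)" and nonempty: "\<forall>\<^sub>F n in F. H n \<noteq> {}"
    and slices: "\<And>i. i \<in> I \<Longrightarrow> ((\<lambda>n. proportion (slice i 1 (H n)) (H n)) \<longlongrightarrow> 0) F"
    and d_pos: "0 < d"
  shows "((\<lambda>n. proportion (multiples d I (H n)) (H n)) \<longlongrightarrow> 1 / real d ^ card I) F"
proof (rule tendsto_sandwich)
  let ?lower = "\<lambda>n. 1 / real d ^ card I * (1 - d * (\<Sum>i\<in>I. proportion (slice i 1 (H n)) (H n)))"
  have "(?lower \<longlongrightarrow> 1 / real d ^ card I * (1 - real d * (\<Sum>i\<in>I. 0))) F"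
    by (intro tendsto_mult tendsto_diff tendsto_const tendsto_sum slices)
  then show "(?lower \<longlongrightarrow> 1 / real d ^ card I) F"
    by simp
  show "\<forall>\<^sub>F n in F. ?lower n \<le> proportion (multiples d I (H n)) (H n)"
    using nonempty by eventually_elim (rule finite_down_set.proportion_multiples_ge[OF down d_pos])
  show "\<forall>\<^sub>F n in F. proportion (multiples d I (H n)) (H n) \<le> 1 / real d ^ card I"
    by (intro always_eventually allI finite_down_set.proportion_multiples_le[OF down d_pos])
qed simp

subsection \<open>Negligibility of the slices\<close>

locale transfer_closed_down_set = finite_down_set +
  assumes transfer_closed: "\<lbrakk>x \<in> H; i \<in> I; j \<in> I; i \<noteq> j; x i = 1; 1 \<le> c; c \<le> x j\<rbrakk> \<Longrightarrow>
    x(i := c, j := x j div c) \<in> H"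
begin

lemma card_slice_one_ge_le:
  assumes "i \<in> I" "j \<in> I" "i \<noteq> j" and "1 \<le> c"
  shows "card {x \<in> slice i 1 H. c \<le> x j} \<le> c * card (slice i c H)"
proof -
  define transfer where "transfer x = (x j mod c, x(i := c, j := x j div c))" for x
  define undo where "undo = (\<lambda>(m, y). y(i := 1, j := c * y j + m))"
  have "card {x \<in> slice i 1 H. c \<le> x j} \<le> card ({..<c} \<times> slice i c H)"
  proof (rule card_inj_on_le)
    show "inj_on transfer {x \<in> slice i 1 H. c \<le> x j}"
      by (rule inj_on_inverseI[of _ undo]) (auto simp: transfer_def undo_def slice_def fun_eq_iff)
    show "transfer ` {x \<in> slice i 1 H. c \<le> x j} \<subseteq> {..<c} \<times> slice i c H"
      using assms by (auto simp: transfer_def slice_def transfer_closed)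
  qed (simp add: finite_slice)
  then show ?thesis by (simp add: card_cartesian_product)
qed

lemma card_slice_one_le:
  assumes "i \<in> I" and "1 \<le> c"
  shows "card (slice i 1 H) \<le> c ^ card I + card I * c * card (slice i c H)"
proof -
  let ?large = "\<lambda>j. {x \<in> slice i 1 H. c \<le> x j}"
  have "slice i 1 H \<subseteq> (I \<rightarrow>\<^sub>E {1..c}) \<union> (\<Union>j\<in>I - {i}. ?large j)"
  proof
    fix x assume x_in: "x \<in> slice i 1 H"
    then have "x \<in> I \<rightarrow>\<^sub>E {1..}" "x i = 1" using subset_PiE by (auto simp: slice_def)
    moreover have "x \<in> (\<Union>j\<in>I - {i}. ?large j) \<or> (\<forall>j\<in>I - {i}. x j < c)"
      using x_in by (auto simp: not_le)
    ultimately show "x \<in> (I \<rightarrow>\<^sub>E {1..c}) \<union> (\<Union>j\<in>I - {i}. ?large j)"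
      using assms by (force simp: PiE_iff)
  qed
  then have "card (slice i 1 H) \<le> card ((I \<rightarrow>\<^sub>E {1..c}) \<union> (\<Union>j\<in>I - {i}. ?large j))"
    using finite_index finite_slice by (intro card_mono) (auto intro!: finite_PiE)
  also have "\<dots> \<le> card (I \<rightarrow>\<^sub>E {1..c}) + card (\<Union>j\<in>I - {i}. ?large j)"
    by (rule card_Un_le)
  also have "card (I \<rightarrow>\<^sub>E {1..c}) = c ^ card I"
    using finite_index by (simp add: card_funcsetE)
  also have "card (\<Union>j\<in>I - {i}. ?large j) \<le> (\<Sum>j\<in>I - {i}. card (?large j))"
    using finite_index by (intro card_UN_le) simp
  also have "\<dots> \<le> (\<Sum>j\<in>I - {i}. c * card (slice i c H))"
    using assms by (intro sum_mono card_slice_one_ge_le) auto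
  also have "\<dots> \<le> card I * c * card (slice i c H)"
    using finite_index by (simp add: card_Diff_subset_Int)
  finally show ?thesis by simp
qed

lemma harm_mult_card_slice_one_le:
  assumes "i \<in> I"
  shows "harm K * real (card (slice i 1 H)) \<le> card I * real (card H) + (\<Sum>c=1..K. real c ^ card I)"
proof -
  have term_le: "inverse (real c) * real (card (slice i 1 H)) \<le> card I * real (card (slice i c H)) + real c ^ card I"
    if "c \<in> {1..K}" for c
  proof -
    have "real (card (slice i 1 H)) \<le> real (c ^ card I + card I * c * card (slice i c H))"
      using that assms by (intro of_nat_mono card_slice_one_le) auto
    also have "\<dots> \<le> real c * (card I * real (card (slice i c H)) + real c ^ card I)"
      using that by (simp add: distrib_left)
    finally show ?thesis using that by (simp add: field_simps)
  qed
  have "(\<Sum>c=1..K. card (slice i c H)) = card (\<Union>c\<in>{1..K}. slice i c H)"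
    by (rule card_UN_disjoint[symmetric]) (simp_all add: finite_slice, auto simp: slice_def)
  also have "\<dots> \<le> card H"
    by (rule card_mono[OF finite_points]) (auto simp: slice_def)
  finally have sum_slices_le: "(\<Sum>c=1..K. real (card (slice i c H))) \<le> real (card H)"
    by (simp flip: of_nat_sum)
  have "harm K * real (card (slice i 1 H)) \<le> (\<Sum>c=1..K. card I * real (card (slice i c H)) + real c ^ card I)"
    unfolding harm_def sum_distrib_right by (rule sum_mono) (rule term_le)
  also have "\<dots> = card I * (\<Sum>c=1..K. real (card (slice i c H))) + (\<Sum>c=1..K. real c ^ card I)"
    by (simp add: sum.distrib sum_distrib_left)
  also have "\<dots> \<le> card I * real (card H) + (\<Sum>c=1..K. real c ^ card I)"
    using sum_slices_le by (simp add: mult_left_mono)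
  finally show ?thesis .
qed

end

lemma tendsto_proportion_slice_one:
  fixes H :: "'n \<Rightarrow> ('i \<Rightarrow> nat) set"
  assumes closed: "\<And>n. transfer_closed_down_set I (H n)"
    and infinite: "filterlim (\<lambda>n. card (H n)) at_top F" and member: "i \<in> I"
  shows "((\<lambda>n. proportion (slice i 1 (H n)) (H n)) \<longlongrightarrow> 0) F"
proof (rule tendstoI)
  fix e :: real assume "0 < e"
  have "0 < card I"
    using member closed by (auto simp: card_gt_0_iff transfer_closed_down_set_def finite_down_set_def)
  then have "\<forall>\<^sub>F K in sequentially. 2 * card I / e < (harm K :: real)"
    using harm_at_top by (simp add: filterlim_at_top_dense)
  then obtain K where harm_large: "2 * card I / e < (harm K :: real)"
    by (auto simp: eventually_sequentially)
  define C where "C = (\<Sum>c=1..K. real c ^ card I)"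
  have "\<forall>\<^sub>F n in F. max 0 (C / card I) < real (card (H n))"
    using filterlim_compose[OF filterlim_real_sequentially infinite]
    unfolding filterlim_at_top_dense by blast
  then show "\<forall>\<^sub>F n in F. dist (proportion (slice i 1 (H n)) (H n)) 0 < e"
  proof eventually_elim
    case (elim n)
    have harm_pos: "0 < (harm K :: real)"
      using \<open>0 < e\<close> by (intro le_less_trans[OF _ harm_large]) simp
    have "harm K * real (card (slice i 1 (H n))) \<le> card I * real (card (H n)) + C"
      unfolding C_def by (rule transfer_closed_down_set.harm_mult_card_slice_one_le[OF closed member])
    also have "C \<le> card I * real (card (H n))"
      using elim \<open>0 < card I\<close> by (simp add: field_simps)
    also have "card I * real (card (H n)) + \<dots> = 2 * card I * real (card (H n))"
      by simp
    also have "\<dots> < harm K * (e * real (card (H n)))"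
      using harm_large \<open>0 < e\<close> elim by (simp add: field_simps)
    finally have "real (card (slice i 1 (H n))) < e * real (card (H n))"
      using harm_pos by simp
    then show ?case using elim by (simp add: proportion_def field_simps)
  qed
qed

subsection \<open>The hyperbolic region\<close>

lemma finite_hyperbolic_region:
  assumes "1 \<le> l" "l \<le> r"
  shows "finite (hyperbolic_region l r n)"
proof (rule finite_subset)
  have "x k \<le> n" if "x \<in> hyperbolic_region l r n" "k \<in> {1..r}" for x k
    using member_le_elem_sym[of "{1..r}" l k x] that assms
    by (auto simp: hyperbolic_region_def esym_eq_elem_sym PiE_iff)
  then show "hyperbolic_region l r n \<subseteq> {1..r} \<rightarrow>\<^sub>E {..n}"
    by (auto simp: hyperbolic_region_def PiE_def extensional_def)
qed (auto intro: finite_PiE)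

lemma add_div_le_Suc:
  fixes a c :: nat
  assumes "1 \<le> c" "c \<le> a"
  shows "c + a div c \<le> 1 + a"
proof -
  define q where "q = a div c"
  have "1 \<le> q" using assms by (simp add: q_def Suc_le_eq div_greater_zero_iff)
  then have "0 \<le> (int c - 1) * (int q - 1)" using assms by simp
  then have "int (c + q) \<le> int (1 + c * q)" by (simp add: algebra_simps)
  also have "\<dots> \<le> int (1 + a)" by (simp add: q_def flip: of_nat_mult)
  finally show ?thesis unfolding q_def by simp
qed

text \<open>
  Trading a coordinate \<open>x\<^sub>j \<ge> c\<close> for \<open>x\<^sub>j div c\<close> while raising \<open>x\<^sub>i\<close> from \<open>1\<close> to \<open>c\<close> increases neither
  the sum nor the product of the two coordinates, hence does not leave the region.
\<close>
lemma transfer_closed_hyperbolic_region: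
  assumes "1 \<le> l" "l \<le> r"
  shows "transfer_closed_down_set {1..r} (hyperbolic_region l r n)"
proof
  show "finite (hyperbolic_region l r n)"
    by (rule finite_hyperbolic_region[OF assms])
  show "y \<in> hyperbolic_region l r n"
    if "x \<in> hyperbolic_region l r n" "y \<in> {1..r} \<rightarrow>\<^sub>E {1..}" "\<And>k. k \<in> {1..r} \<Longrightarrow> y k \<le> x k" for x y
    using that elem_sym_mono[of "{1..r}" y x l] by (auto simp: hyperbolic_region_def esym_eq_elem_sym)
  fix x i j and c :: nat
  assume point: "x \<in> hyperbolic_region l r n" "x i = 1" "1 \<le> c" "c \<le> x j"
    and indices: "i \<in> {1..r}" "j \<in> {1..r}" "i \<noteq> j"
  define y where "y = x(i := c, j := x j div c)"
  have "elem_sym l {1..r} y \<le> elem_sym l {1..r} x"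
  proof (rule elem_sym_mono_sum_prod[of _ i j])
    show "y i + y j \<le> x i + x j" "y i * y j \<le> x i * x j"
      using point indices add_div_le_Suc[of c "x j"] by (auto simp: y_def)
  qed (use indices in \<open>auto simp: y_def\<close>)
  moreover have "y \<in> {1..r} \<rightarrow>\<^sub>E {1..}"
    using point indices by (auto simp: y_def hyperbolic_region_def PiE_iff extensional_def Suc_le_eq div_greater_zero_iff)
  ultimately show "x(i := c, j := x j div c) \<in> hyperbolic_region l r n"
    using point by (simp add: hyperbolic_region_def esym_eq_elem_sym flip: y_def)
qed (auto simp: hyperbolic_region_def)

lemma filterlim_card_sublevel_set:
  fixes f :: "'a \<Rightarrow> nat"
  assumes "infinite A" and finite: "\<And>n. finite {x \<in> A. f x \<le> n}"
  shows "filterlim (\<lambda>n. card {x \<in> A. f x \<le> n}) at_top sequentially"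
  unfolding filterlim_at_top
proof
  fix m
  obtain B where subset: "finite B" "card B = m" "B \<subseteq> A"
    using infinite_arbitrarily_large[OF \<open>infinite A\<close>] by blast
  show "\<forall>\<^sub>F n in sequentially. m \<le> card {x \<in> A. f x \<le> n}"
  proof (rule eventually_sequentiallyI)
    fix n assume "sum f B \<le> n"
    then have "B \<subseteq> {x \<in> A. f x \<le> n}"
      using subset by (auto intro: order_trans[OF member_le_sum])
    then show "m \<le> card {x \<in> A. f x \<le> n}"
      using card_mono[OF finite] subset by blast
  qed
qed

lemma filterlim_card_hyperbolic_region:
  assumes "1 \<le> l" "l \<le> r"
  shows "filterlim (\<lambda>n. card (hyperbolic_region l r n)) at_top sequentially"
  unfolding hyperbolic_region_def
proof (rule filterlim_card_sublevel_set)
  have "infinite {1::nat..}" by (rule infinite_Ici)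
  with assms show "infinite ({1..r} \<rightarrow>\<^sub>E {1::nat..})"
    by (subst finite_PiE_iff) (auto simp: PiE_eq_empty_iff)
qed (rule finite_hyperbolic_region[OF assms, unfolded hyperbolic_region_def])

lemma tendsto_proportion_multiples_hyperbolic_region:
  assumes degree: "1 \<le> l" "l \<le> r" and "0 < d"
  shows "(\<lambda>n. proportion (multiples d {1..r} (hyperbolic_region l r n)) (hyperbolic_region l r n))
           \<longlonglongrightarrow> 1 / real d ^ r"
proof -
  note closed = transfer_closed_hyperbolic_region[OF degree]
  note infinite = filterlim_card_hyperbolic_region[OF degree]
  have "\<forall>\<^sub>F n in sequentially. 1 \<le> card (hyperbolic_region l r n)"
    using infinite by (simp add: filterlim_at_top)
  then have "\<forall>\<^sub>F n in sequentially. hyperbolic_region l r n \<noteq> {}"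
    by eventually_elim auto
  then have "(\<lambda>n. proportion (multiples d {1..r} (hyperbolic_region l r n)) (hyperbolic_region l r n))
      \<longlonglongrightarrow> 1 / real d ^ card {1..r}"
    by (intro tendsto_proportion_multiples tendsto_proportion_slice_one[OF closed infinite] \<open>0 < d\<close>)
      (use closed in \<open>auto intro: transfer_closed_down_set.axioms\<close>)
  then show ?thesis by simp
qed

subsection \<open>Convergence in law from divisibility probabilities\<close>

lemma (in finite_measure) measure_dvd_eq_sum_gcd:
  fixes X :: "'a \<Rightarrow> nat"
  assumes [measurable]: "X \<in> measurable M (count_space UNIV)" and "0 < D" and "m dvd D"
  shows "\<P>(\<omega> in M. m dvd X \<omega>) = (\<Sum>k | m dvd k \<and> k dvd D. \<P>(\<omega> in M. gcd (X \<omega>) D = k))"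
proof -
  have "finite {k. m dvd k \<and> k dvd D}"
    using assms by (auto intro: finite_subset[OF _ finite_divisors_nat[of D]])
  moreover have "{\<omega> \<in> space M. m dvd X \<omega>} =
      (\<Union>k\<in>{k. m dvd k \<and> k dvd D}. {\<omega> \<in> space M. gcd (X \<omega>) D = k})"
    using assms by auto
  ultimately show ?thesis
    by (auto intro!: finite_measure_finite_Union simp: disjoint_family_on_def)
qed

lemma (in finite_measure) measure_gcd_eq:
  fixes X :: "'a \<Rightarrow> nat"
  assumes "X \<in> measurable M (count_space UNIV)" and "0 < D" and "m dvd D"
  shows "\<P>(\<omega> in M. gcd (X \<omega>) D = m) =
    \<P>(\<omega> in M. m dvd X \<omega>) - (\<Sum>k\<in>{k. m dvd k \<and> k dvd D} - {m}. \<P>(\<omega> in M. gcd (X \<omega>) D = k))"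
proof -
  have "finite {k. m dvd k \<and> k dvd D}"
    using assms by (auto intro: finite_subset[OF _ finite_divisors_nat[of D]])
  then show ?thesis
    using measure_dvd_eq_sum_gcd[OF assms] assms by (simp add: sum.remove[of _ m])
qed

lemma (in finite_measure) integral_finite_range:
  fixes Z :: "'a \<Rightarrow> 'c" and h :: "'c \<Rightarrow> 'd::{banach, second_countable_topology}"
  assumes [measurable]: "Z \<in> measurable M (count_space UNIV)"
    and range: "finite S" "\<And>\<omega>. \<omega> \<in> space M \<Longrightarrow> Z \<omega> \<in> S"
  shows "(\<integral>\<omega>. h (Z \<omega>) \<partial>M) = (\<Sum>z\<in>S. \<P>(\<omega> in M. Z \<omega> = z) *\<^sub>R h z)"
proof -
  have "(\<integral>\<omega>. h (Z \<omega>) \<partial>M) = (\<integral>\<omega>. (\<Sum>z\<in>S. indicator {\<omega> \<in> space M. Z \<omega> = z} \<omega> *\<^sub>R h z) \<partial>M)"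
  proof (rule Bochner_Integration.integral_cong)
    fix \<omega> assume "\<omega> \<in> space M"
    then have "(\<Sum>z\<in>S. indicator {\<omega> \<in> space M. Z \<omega> = z} \<omega> *\<^sub>R h z) = (\<Sum>z\<in>S. if z = Z \<omega> then h z else 0)"
      by (intro sum.cong) (auto simp: indicator_def)
    then show "h (Z \<omega>) = (\<Sum>z\<in>S. indicator {\<omega> \<in> space M. Z \<omega> = z} \<omega> *\<^sub>R h z)"
      using range \<open>\<omega> \<in> space M\<close> by simp
  qed simp
  then show ?thesis
    by (simp add: Bochner_Integration.integral_sum integrable_scaleR_left less_top[symmetric])
qed

lemma (in finite_measure) norm_integral_diff_le:
  fixes f g :: "'a \<Rightarrow> 'c::{banach, second_countable_topology}"
  assumes [measurable]: "f \<in> borel_measurable M" "g \<in> borel_measurable M" "E \<in> sets M"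
    and bound: "\<And>\<omega>. \<omega> \<in> space M \<Longrightarrow> norm (f \<omega>) \<le> b" "\<And>\<omega>. \<omega> \<in> space M \<Longrightarrow> norm (g \<omega>) \<le> b"
    and agree: "\<And>\<omega>. \<omega> \<in> space M - E \<Longrightarrow> f \<omega> = g \<omega>"
  shows "norm ((\<integral>\<omega>. f \<omega> \<partial>M) - (\<integral>\<omega>. g \<omega> \<partial>M)) \<le> 2 * b * measure M E"
proof -
  have integrable: "integrable M f" "integrable M g"
    by (rule integrable_const_bound[where B = b]; use bound in auto)+
  then have "norm ((\<integral>\<omega>. f \<omega> \<partial>M) - (\<integral>\<omega>. g \<omega> \<partial>M)) = norm (\<integral>\<omega>. f \<omega> - g \<omega> \<partial>M)"
    by simp
  also have "\<dots> \<le> (\<integral>\<omega>. norm (f \<omega> - g \<omega>) \<partial>M)"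
    by (rule integral_norm_bound)
  also have "\<dots> \<le> (\<integral>\<omega>. 2 * b * indicator E \<omega> \<partial>M)"
  proof (rule integral_mono)
    fix \<omega> assume in_space: "\<omega> \<in> space M"
    show "norm (f \<omega> - g \<omega>) \<le> 2 * b * indicator E \<omega>"
      using norm_triangle_ineq4[of "f \<omega>" "g \<omega>"] bound[OF in_space] agree in_space by (auto simp: indicator_def)
  qed (use integrable in \<open>auto simp: less_top[symmetric]\<close>)
  also have "\<dots> = 2 * b * measure M E" by simp
  finally show ?thesis .
qed

lemma gcd_fact_eq_self:
  fixes m :: nat
  assumes "\<And>d. K < d \<Longrightarrow> \<not> d dvd m"
  shows "gcd m (fact K) = m"
proof -
  have "m \<noteq> 0" using assms[of "Suc K"] by (metis dvd_0_right lessI)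
  moreover have "m \<le> K" using assms[of m] by (meson dvd_refl not_le)
  ultimately have "m dvd fact K" by (intro dvd_fact) auto
  then show ?thesis by simp
qed

context prob_space
begin

lemma prob_large_divisor_le:
  fixes X :: "'a \<Rightarrow> nat"
  assumes [measurable]: "X \<in> measurable M (count_space UNIV)"
    and summable: "summable u" and prob_dvd_le: "\<And>d. 0 < d \<Longrightarrow> \<P>(\<omega> in M. d dvd X \<omega>) \<le> u d"
  shows "\<P>(\<omega> in M. \<exists>d>K. d dvd X \<omega>) \<le> (\<Sum>i. u (i + Suc K))"
proof -
  define A where "A i = {\<omega> \<in> space M. (i + Suc K) dvd X \<omega>}" for i
  have summable_u: "summable (\<lambda>i. u (i + Suc K))"
    using summable by (rule summable_ignore_initial_segment)
  have prob_A: "prob (A i) \<le> u (i + Suc K)" for i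
    unfolding A_def by (rule prob_dvd_le) simp
  have summable_A: "summable (\<lambda>i. prob (A i))"
    by (rule summable_comparison_test'[OF summable_u, of 0]) (use prob_A in simp)
  have "(\<exists>d>K. d dvd m) \<longleftrightarrow> (\<exists>i. (i + Suc K) dvd m)" for m :: nat
    by (metis Suc_le_eq le_add2 le_add_diff_inverse2)
  then have "{\<omega> \<in> space M. \<exists>d>K. d dvd X \<omega>} = (\<Union>i. A i)"
    by (auto simp: A_def)
  also have "prob \<dots> \<le> (\<Sum>i. prob (A i))"
    using summable_A by (intro finite_measure_subadditive_countably) (auto simp: A_def)
  also have "\<dots> \<le> (\<Sum>i. u (i + Suc K))"
    by (intro suminf_le prob_A summable_A summable_u)
  finally show ?thesis .
qed

lemma norm_expectation_gcd_fact_le: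
  fixes X :: "'a \<Rightarrow> nat" and h :: "nat \<Rightarrow> 'c::{banach, second_countable_topology}"
  assumes measurable_X[measurable]: "X \<in> measurable M (count_space UNIV)" and bounded: "\<And>m. norm (h m) \<le> b"
    and summable: "summable u" and prob_dvd_le: "\<And>d. 0 < d \<Longrightarrow> \<P>(\<omega> in M. d dvd X \<omega>) \<le> u d"
  shows "norm (expectation (\<lambda>\<omega>. h (X \<omega>)) - expectation (\<lambda>\<omega>. h (gcd (X \<omega>) (fact K))))
           \<le> 2 * b * (\<Sum>i. u (i + Suc K))"
proof -
  have "0 \<le> b" using norm_ge_zero bounded by (rule order_trans)
  have "norm (expectation (\<lambda>\<omega>. h (X \<omega>)) - expectation (\<lambda>\<omega>. h (gcd (X \<omega>) (fact K))))
      \<le> 2 * b * \<P>(\<omega> in M. \<exists>d>K. d dvd X \<omega>)"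
  proof (rule norm_integral_diff_le)
    fix \<omega> assume "\<omega> \<in> space M - {\<omega> \<in> space M. \<exists>d>K. d dvd X \<omega>}"
    then show "h (X \<omega>) = h (gcd (X \<omega>) (fact K))"
      by (subst gcd_fact_eq_self) auto
  qed (use bounded in auto)
  also have "\<dots> \<le> 2 * b * (\<Sum>i. u (i + Suc K))"
    using prob_large_divisor_le[OF measurable_X summable prob_dvd_le] \<open>0 \<le> b\<close> by (intro mult_left_mono) auto
  finally show ?thesis .
qed

end

locale dvd_prob_convergence =
  fixes F :: "'i filter" and N :: "'i \<Rightarrow> 'a measure" and X :: "'i \<Rightarrow> 'a \<Rightarrow> nat"
    and M :: "'b measure" and Y :: "'b \<Rightarrow> nat" and u :: "nat \<Rightarrow> real"
  assumes prob_space_limit: "prob_space M" and measurable_limit: "Y \<in> measurable M (count_space UNIV)"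
    and eventually_measurable: "\<forall>\<^sub>F n in F. prob_space (N n) \<and> X n \<in> measurable (N n) (count_space UNIV)"
    and tendsto_prob_dvd: "0 < d \<Longrightarrow> ((\<lambda>n. \<P>(\<omega> in N n. d dvd X n \<omega>)) \<longlongrightarrow> \<P>(\<omega> in M. d dvd Y \<omega>)) F"
    and summable_bound: "summable u"
    and eventually_prob_dvd_le: "\<forall>\<^sub>F n in F. \<forall>d>0. \<P>(\<omega> in N n. d dvd X n \<omega>) \<le> u d"
begin

sublocale limit: prob_space M
  by (rule prob_space_limit)

text \<open>Downward induction on \<open>m\<close>: the summands in \<open>measure_gcd_eq\<close> belong to larger divisors of \<open>D\<close>.\<close>
lemma tendsto_prob_gcd:
  assumes "0 < D" and "m dvd D"
  shows "((\<lambda>n. \<P>(\<omega> in N n. gcd (X n \<omega>) D = m)) \<longlongrightarrow> \<P>(\<omega> in M. gcd (Y \<omega>) D = m)) F"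
  using \<open>m dvd D\<close>
proof (induction m rule: measure_induct_rule[where f = "\<lambda>m. D - m"])
  case (less m)
  define S where "S = {k. m dvd k \<and> k dvd D} - {m}"
  have "0 < m" using less.prems \<open>0 < D\<close> by (auto intro: Nat.gr0I)
  note gcd_eq = finite_measure.measure_gcd_eq[OF prob_space.finite_measure _ \<open>0 < D\<close> less.prems, folded S_def]
  have "((\<lambda>n. \<P>(\<omega> in N n. m dvd X n \<omega>) - (\<Sum>k\<in>S. \<P>(\<omega> in N n. gcd (X n \<omega>) D = k)))
      \<longlongrightarrow> \<P>(\<omega> in M. m dvd Y \<omega>) - (\<Sum>k\<in>S. \<P>(\<omega> in M. gcd (Y \<omega>) D = k))) F"
  proof (intro tendsto_diff tendsto_prob_dvd \<open>0 < m\<close> tendsto_sum)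
    fix k assume "k \<in> S"
    then have divisor: "m dvd k" "k dvd D" "k \<noteq> m" by (auto simp: S_def)
    then have "0 < k" using divisor \<open>0 < D\<close> by (auto intro: Nat.gr0I)
    then have "m < k" "k \<le> D" using divisor \<open>0 < D\<close> by (auto dest!: dvd_imp_le)
    then show "((\<lambda>n. \<P>(\<omega> in N n. gcd (X n \<omega>) D = k)) \<longlongrightarrow> \<P>(\<omega> in M. gcd (Y \<omega>) D = k)) F"
      using divisor by (intro less.IH) auto
  qed
  moreover have "\<forall>\<^sub>F n in F. \<P>(\<omega> in N n. m dvd X n \<omega>) - (\<Sum>k\<in>S. \<P>(\<omega> in N n. gcd (X n \<omega>) D = k)) =
      \<P>(\<omega> in N n. gcd (X n \<omega>) D = m)"
    using eventually_measurable by eventually_elim (simp add: gcd_eq)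
  ultimately show ?case
    by (simp add: gcd_eq prob_space_limit measurable_limit tendsto_cong)
qed

lemma tendsto_expectation_gcd:
  fixes h :: "nat \<Rightarrow> 'c::{banach, second_countable_topology}"
  assumes "0 < D"
  shows "((\<lambda>n. \<integral>\<omega>. h (gcd (X n \<omega>) D) \<partial>N n) \<longlongrightarrow> (\<integral>\<omega>. h (gcd (Y \<omega>) D) \<partial>M)) F"
proof -
  have expectation_eq: "(\<integral>\<omega>. h (gcd (Z \<omega>) D) \<partial>L) = (\<Sum>m | m dvd D. \<P>(\<omega> in L. gcd (Z \<omega>) D = m) *\<^sub>R h m)"
    if "prob_space L" and [measurable]: "Z \<in> measurable L (count_space UNIV)" for L :: "'d measure" and Z
  proof -
    interpret prob_space L by fact
    show ?thesis
      by (rule integral_finite_range) (use assms in \<open>auto intro: finite_divisors_nat\<close>)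
  qed
  have "((\<lambda>n. \<Sum>m | m dvd D. \<P>(\<omega> in N n. gcd (X n \<omega>) D = m) *\<^sub>R h m)
      \<longlongrightarrow> (\<Sum>m | m dvd D. \<P>(\<omega> in M. gcd (Y \<omega>) D = m) *\<^sub>R h m)) F"
    using assms by (intro tendsto_sum tendsto_scaleR tendsto_const tendsto_prob_gcd) auto
  moreover have "\<forall>\<^sub>F n in F. (\<Sum>m | m dvd D. \<P>(\<omega> in N n. gcd (X n \<omega>) D = m) *\<^sub>R h m) =
      (\<integral>\<omega>. h (gcd (X n \<omega>) D) \<partial>N n)"
    using eventually_measurable by eventually_elim (simp add: expectation_eq)
  ultimately show ?thesis
    by (simp add: expectation_eq prob_space_limit measurable_limit tendsto_cong)
qed

lemma prob_dvd_limit_le: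
  assumes "F \<noteq> bot" and "0 < d"
  shows "\<P>(\<omega> in M. d dvd Y \<omega>) \<le> u d"
  by (rule tendsto_upperbound[OF tendsto_prob_dvd[OF \<open>0 < d\<close>] _ \<open>F \<noteq> bot\<close>])
    (use eventually_prob_dvd_le \<open>0 < d\<close> in \<open>auto elim: eventually_mono\<close>)

lemma tendsto_expectation:
  fixes h :: "nat \<Rightarrow> 'c::{banach, second_countable_topology}"
  assumes bounded: "\<And>m. norm (h m) \<le> b"
  shows "((\<lambda>n. \<integral>\<omega>. h (X n \<omega>) \<partial>N n) \<longlongrightarrow> (\<integral>\<omega>. h (Y \<omega>) \<partial>M)) F"
proof (cases "F = bot")
  case False
  show ?thesis
  proof (rule tendstoI)
    fix e :: real assume "0 < e"
    define tail where "tail K = 2 * b * (\<Sum>i. u (i + Suc K))" for K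
    have "tail \<longlonglongrightarrow> 2 * b * 0"
      unfolding tail_def by (intro tendsto_mult tendsto_const LIMSEQ_Suc suminf_exist_split2 summable_bound)
    then have "\<forall>\<^sub>F K in sequentially. tail K < e / 3"
      using \<open>0 < e\<close> by (intro order_tendstoD) auto
    then obtain K where tail_less: "tail K < e / 3"
      by (auto simp: eventually_sequentially)
    have truncate_limit: "norm ((\<integral>\<omega>. h (Y \<omega>) \<partial>M) - (\<integral>\<omega>. h (gcd (Y \<omega>) (fact K)) \<partial>M)) \<le> tail K"
      unfolding tail_def using prob_dvd_limit_le[OF False]
      by (intro limit.norm_expectation_gcd_fact_le measurable_limit bounded summable_bound)
    have "\<forall>\<^sub>F n in F. dist (\<integral>\<omega>. h (gcd (X n \<omega>) (fact K)) \<partial>N n) (\<integral>\<omega>. h (gcd (Y \<omega>) (fact K)) \<partial>M) < e / 3"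
      using \<open>0 < e\<close> by (intro tendstoD[OF tendsto_expectation_gcd]) auto
    then show "\<forall>\<^sub>F n in F. dist (\<integral>\<omega>. h (X n \<omega>) \<partial>N n) (\<integral>\<omega>. h (Y \<omega>) \<partial>M) < e"
      using eventually_measurable eventually_prob_dvd_le
    proof eventually_elim
      case (elim n)
      interpret N: prob_space "N n" using elim by simp
      have "norm ((\<integral>\<omega>. h (X n \<omega>) \<partial>N n) - (\<integral>\<omega>. h (gcd (X n \<omega>) (fact K)) \<partial>N n)) \<le> tail K"
        unfolding tail_def using elim by (intro N.norm_expectation_gcd_fact_le bounded summable_bound) auto
      with truncate_limit tail_less elim(1) show ?case
        unfolding dist_norm by norm
    qed
  qed
qed simp

end

lemma converges_in_distribution_of_dvd_prob_convergence:
  fixes f :: "nat \<Rightarrow> 'c::metric_space"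
  assumes "dvd_prob_convergence sequentially N X M Y u"
  shows "converges_in_distribution N (\<lambda>n \<omega>. f (X n \<omega>)) M (\<lambda>\<omega>. f (Y \<omega>))"
proof -
  interpret dvd_prob_convergence sequentially N X M Y u by fact
  have "(\<lambda>n. \<integral>\<omega>. g (f (X n \<omega>)) \<partial>N n) \<longlonglongrightarrow> (\<integral>\<omega>. g (f (Y \<omega>)) \<partial>M)"
    if bounded: "bounded (range g)" for g :: "'c \<Rightarrow> real"
  proof -
    obtain b where "norm (g z) \<le> b" for z
      using bounded by (auto simp: bounded_iff)
    then show ?thesis by (intro tendsto_expectation[where h = "\<lambda>m. g (f m)"])
  qed
  moreover have "\<forall>\<^sub>F n in sequentially. (\<lambda>\<omega>. f (X n \<omega>)) \<in> borel_measurable (N n)"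
    using eventually_measurable by eventually_elim (auto intro: measurable_compose)
  moreover have "(\<lambda>\<omega>. f (Y \<omega>)) \<in> borel_measurable M"
    by (rule measurable_compose[OF measurable_limit]) simp
  ultimately show ?thesis by (simp add: converges_in_distribution_def)
qed

subsection \<open>Random products of prime powers\<close>

definition prime_power_prod :: "(nat \<Rightarrow> nat) \<Rightarrow> nat" where
  "prime_power_prod e = (\<Prod>p. if prime p then p ^ e p else 1)"

lemma prime_power_prod_finite:
  assumes "finite {p. prime p \<and> e p \<noteq> 0}"
  shows "prime_power_prod e = (\<Prod>p | prime p \<and> e p \<noteq> 0. p ^ e p)"
proof -
  let ?S = "{p. prime p \<and> e p \<noteq> 0}"
  have "prime_power_prod e = (\<Prod>p\<in>?S. if prime p then p ^ e p else 1)"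
    unfolding prime_power_prod_def
    by (rule has_prod_unique[symmetric], rule has_prod_finite) (use assms in auto)
  then show ?thesis by simp
qed

lemma dvd_prime_power_prod_iff:
  assumes finite: "finite {p. prime p \<and> e p \<noteq> 0}" and "0 < d"
  shows "d dvd prime_power_prod e \<longleftrightarrow> (\<forall>p\<in>prime_factors d. multiplicity p d \<le> e p)"
proof -
  have "multiplicity p (prime_power_prod e) = e p" if "prime p" for p
    unfolding prime_power_prod_finite[OF finite]
    using finite that by (subst multiplicity_prod_prime_powers) auto
  moreover have "prime_power_prod e \<noteq> 0"
    unfolding prime_power_prod_finite[OF finite] using finite by auto
  ultimately have "d dvd prime_power_prod e \<longleftrightarrow> (\<forall>p. prime p \<longrightarrow> multiplicity p d \<le> e p)"
    using assms by (subst prime_multiplicity_le_imp_dvd) auto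
  also have "\<dots> \<longleftrightarrow> (\<forall>p\<in>prime_factors d. multiplicity p d \<le> e p)"
    using assms by (auto simp: prime_factors_multiplicity)
  finally show ?thesis .
qed

lemma measurable_prod_count_space:
  fixes f :: "'i \<Rightarrow> 'a \<Rightarrow> 'c::{countable, comm_monoid_mult}"
  assumes "\<And>i. i \<in> I \<Longrightarrow> f i \<in> measurable M (count_space UNIV)"
  shows "(\<lambda>\<omega>. \<Prod>i\<in>I. f i \<omega>) \<in> measurable M (count_space UNIV)"
  using assms
proof (induction I rule: infinite_finite_induct)
  case (insert i I)
  have "(\<lambda>\<omega>. f i \<omega> * (\<Prod>i\<in>I. f i \<omega>)) \<in> measurable M (count_space UNIV)"
    by (rule measurable_compose_countable[where f = "\<lambda>m \<omega>. m * (\<Prod>i\<in>I. f i \<omega>)"])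
      (auto intro!: measurable_compose[OF insert.IH] insert.prems)
  then show ?case using insert by simp
qed simp_all

text \<open>The product is the \<open>THE\<close> of a limit; since a convergent sequence of natural numbers is
  eventually constant, that limit is described by countably many measurable conditions.\<close>
lemma measurable_prodinf_nat:
  fixes f :: "nat \<Rightarrow> 'a \<Rightarrow> nat"
  assumes measurable_factor: "\<And>i. f i \<in> measurable M (count_space UNIV)" and nonzero: "\<And>i \<omega>. f i \<omega> \<noteq> 0"
  shows "(\<lambda>\<omega>. \<Prod>i. f i \<omega>) \<in> measurable M (count_space UNIV)"
  unfolding prodinf_def
proof (rule measurable_THE[where I = UNIV])
  fix q
  have [measurable]: "(\<lambda>\<omega>. \<Prod>i\<le>n. f i \<omega>) \<in> measurable M (count_space UNIV)" for n
    by (rule measurable_prod_count_space[OF measurable_factor])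
  have "(\<lambda>\<omega>. (\<lambda>i. f i \<omega>) has_prod q) =
      (\<lambda>\<omega>. (\<exists>n0. \<forall>n\<ge>n0. (\<Prod>i\<le>n. f i \<omega>) = q) \<and> q \<noteq> 0)"
    by (simp add: has_prod_def raw_has_prod_def nonzero tendsto_discrete eventually_sequentially)
  then show "Measurable.pred M (\<lambda>\<omega>. (\<lambda>i. f i \<omega>) has_prod q)"
    by simp
qed (auto intro: has_prod_unique2)

lemma measurable_prime_power_prod:
  assumes "\<And>p. prime p \<Longrightarrow> E p \<in> measurable M (count_space UNIV)"
  shows "(\<lambda>\<omega>. prime_power_prod (\<lambda>p. E p \<omega>)) \<in> measurable M (count_space UNIV)"
  unfolding prime_power_prod_def
proof (rule measurable_prodinf_nat)
  fix p :: nat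
  show "(\<lambda>\<omega>. if prime p then p ^ E p \<omega> else 1) \<in> measurable M (count_space UNIV)"
    by (cases "prime p") (auto intro: measurable_compose[OF assms])
  show "(if prime p then p ^ E p \<omega> else 1) \<noteq> 0" for \<omega>
    by (auto simp: prime_gt_0_nat)
qed

lemma summable_inverse_power:
  assumes "2 \<le> s"
  shows "summable (\<lambda>n. 1 / real n ^ s)"
  using inverse_power_summable[OF assms, where 'a = real] by (simp add: field_simps)

text \<open>The exponents in the prime factorization of a random integer whose distribution is
  proportional to \<open>m\<^bsup>-s\<^esup>\<close>.\<close>
locale zeta_prime_exponents = prob_space M for M :: "'b measure" +
  fixes E :: "nat \<Rightarrow> 'b \<Rightarrow> nat" and s :: nat
  assumes two_le_s: "2 \<le> s"
    and measurable_exponent: "prime p \<Longrightarrow> E p \<in> measurable M (count_space UNIV)"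
    and prob_exponents_ge: "\<lbrakk>finite S; \<And>p. p \<in> S \<Longrightarrow> prime p\<rbrakk> \<Longrightarrow>
      \<P>(\<omega> in M. \<forall>p\<in>S. a p \<le> E p \<omega>) = 1 / real (\<Prod>p\<in>S. p ^ a p) ^ s"
begin

lemma measurable_prime_power_prod_exponents [measurable]:
  "(\<lambda>\<omega>. prime_power_prod (\<lambda>p. E p \<omega>)) \<in> measurable M (count_space UNIV)"
  by (rule measurable_prime_power_prod[OF measurable_exponent])

lemma AE_finite_exponents: "AE \<omega> in M. finite {p. prime p \<and> E p \<omega> \<noteq> 0}"
proof -
  define A where "A p = {\<omega> \<in> space M. prime p \<and> E p \<omega> \<noteq> 0}" for p
  have events: "A p \<in> events" for p
    using measurable_exponent[of p] by (cases "prime p") (auto simp: A_def)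
  have "prob (A p) \<le> 1 / real p ^ s" for p
  proof (cases "prime p")
    case True
    then show ?thesis
      using prob_exponents_ge[of "{p}" "\<lambda>_. 1"] by (simp add: A_def Suc_le_eq)
  qed (simp add: A_def)
  then have "summable (\<lambda>p. prob (A p))"
    by (intro summable_comparison_test'[OF summable_inverse_power[OF two_le_s], of 0]) simp
  then have "AE \<omega> in M. \<forall>\<^sub>F p in sequentially. \<omega> \<in> space M - A p"
    by (intro borel_cantelli_AE1 events) (auto simp: emeasure_eq_measure)
  then show ?thesis
  proof (rule AE_mp, intro AE_I2 impI)
    fix \<omega> assume "\<omega> \<in> space M" "\<forall>\<^sub>F p in sequentially. \<omega> \<in> space M - A p"
    then have "\<forall>\<^sub>F p in cofinite. \<not> (prime p \<and> E p \<omega> \<noteq> 0)"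
      unfolding cofinite_eq_sequentially by (simp add: A_def)
    then show "finite {p. prime p \<and> E p \<omega> \<noteq> 0}"
      by (simp add: eventually_cofinite)
  qed
qed

lemma prob_dvd_prime_power_prod:
  assumes "0 < d"
  shows "\<P>(\<omega> in M. d dvd prime_power_prod (\<lambda>p. E p \<omega>)) = 1 / real d ^ s"
proof -
  have [measurable]: "E p \<in> measurable M (count_space UNIV)" if "p \<in> prime_factors d" for p
    using that by (intro measurable_exponent) auto
  have "\<P>(\<omega> in M. d dvd prime_power_prod (\<lambda>p. E p \<omega>)) =
      \<P>(\<omega> in M. \<forall>p\<in>prime_factors d. multiplicity p d \<le> E p \<omega>)"
  proof (rule finite_measure_eq_AE)
    show "AE \<omega> in M. \<omega> \<in> {\<omega> \<in> space M. d dvd prime_power_prod (\<lambda>p. E p \<omega>)} \<longleftrightarrow>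
        \<omega> \<in> {\<omega> \<in> space M. \<forall>p\<in>prime_factors d. multiplicity p d \<le> E p \<omega>}"
      using AE_finite_exponents by eventually_elim (simp add: dvd_prime_power_prod_iff assms)
  qed measurable
  also have "\<dots> = 1 / real (\<Prod>p\<in>prime_factors d. p ^ multiplicity p d) ^ s"
    by (rule prob_exponents_ge) auto
  also have "(\<Prod>p\<in>prime_factors d. p ^ multiplicity p d) = d"
    using assms by (simp add: prod_prime_factors)
  finally show ?thesis .
qed

end

lemma (in prob_space) prob_geometric_ge:
  fixes X :: "'a \<Rightarrow> nat" and q :: real
  assumes [measurable]: "X \<in> measurable M (count_space UNIV)"
    and geometric: "\<And>j. \<P>(\<omega> in M. X \<omega> = j) = (1 - q) * q ^ j"
  shows "\<P>(\<omega> in M. j \<le> X \<omega>) = q ^ j"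
proof (induction j)
  case 0
  then show ?case by (simp add: prob_space)
next
  case (Suc j)
  have "{\<omega> \<in> space M. j \<le> X \<omega>} = {\<omega> \<in> space M. X \<omega> = j} \<union> {\<omega> \<in> space M. Suc j \<le> X \<omega>}"
    by auto
  then have "\<P>(\<omega> in M. j \<le> X \<omega>) = \<P>(\<omega> in M. X \<omega> = j) + \<P>(\<omega> in M. Suc j \<le> X \<omega>)"
    by (simp only:) (rule finite_measure_Union; auto)
  with Suc geometric[of j] show ?case by (simp add: algebra_simps)
qed

lemma (in prob_space) prob_Min_geometric_ge:
  fixes G :: "'k \<Rightarrow> nat \<Rightarrow> 'a \<Rightarrow> nat"
  assumes copies: "finite K" "K \<noteq> {}" and primes: "finite S" "\<And>p. p \<in> S \<Longrightarrow> prime p"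
    and indep: "indep_vars (\<lambda>_. count_space UNIV) (\<lambda>(k, p). G k p) (K \<times> {p. prime p})"
    and geometric: "\<And>k p j. k \<in> K \<Longrightarrow> prime p \<Longrightarrow>
      \<P>(\<omega> in M. G k p \<omega> = j) = (1 - 1 / real p) * (1 / real p) ^ j"
  shows "\<P>(\<omega> in M. \<forall>p\<in>S. a p \<le> (MIN k\<in>K. G k p \<omega>)) = 1 / real (\<Prod>p\<in>S. p ^ a p) ^ card K"
proof (cases "S = {}")
  case True
  then show ?thesis by (simp add: prob_space)
next
  case False
  define A where "A i = (case i of (k, p) \<Rightarrow> G k p) -` {a (snd i)..} \<inter> space M" for i
  have prob_A: "prob (A (k, p)) = 1 / real (p ^ a p)" if "k \<in> K" "p \<in> S" for k p
  proof -
    have "A (k, p) = {\<omega> \<in> space M. a p \<le> G k p \<omega>}" by (auto simp: A_def)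
    also have "prob \<dots> = (1 / real p) ^ a p"
      using that primes indep by (intro prob_geometric_ge geometric) (auto simp: indep_vars_def)
    finally show ?thesis by (simp add: power_divide)
  qed
  have "{\<omega> \<in> space M. \<forall>p\<in>S. a p \<le> (MIN k\<in>K. G k p \<omega>)} = (\<Inter>i\<in>K \<times> S. A i)"
    using copies False by (auto simp: A_def)
  also have "prob \<dots> = (\<Prod>i\<in>K \<times> S. prob (A i))"
    unfolding A_def using copies primes False by (intro indep_varsD[OF indep]) auto
  also have "\<dots> = (\<Prod>k\<in>K. \<Prod>p\<in>S. 1 / real (p ^ a p))"
    by (subst prod.cartesian_product) (auto intro!: prod.cong simp: prob_A)
  also have "\<dots> = 1 / real (\<Prod>p\<in>S. p ^ a p) ^ card K"
    by (simp add: prod_dividef power_divide)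
  finally show ?thesis .
qed

lemma (in prob_space) zeta_prime_exponents_Min_geometric:
  fixes G :: "'k \<Rightarrow> nat \<Rightarrow> 'a \<Rightarrow> nat"
  assumes card_K: "2 \<le> card K"
    and indep: "indep_vars (\<lambda>_. count_space UNIV) (\<lambda>(k, p). G k p) (K \<times> {p. prime p})"
    and geometric: "\<And>k p j. k \<in> K \<Longrightarrow> prime p \<Longrightarrow>
      \<P>(\<omega> in M. G k p \<omega> = j) = (1 - 1 / real p) * (1 / real p) ^ j"
  shows "zeta_prime_exponents M (\<lambda>p \<omega>. MIN k\<in>K. G k p \<omega>) (card K)"
proof
  have copies: "finite K" "K \<noteq> {}"
    using card_K by (auto intro: card_ge_0_finite)
  show "(\<lambda>\<omega>. MIN k\<in>K. G k p \<omega>) \<in> measurable M (count_space UNIV)" if "prime p" for p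
    using borel_measurable_Min[of K "\<lambda>k. G k p" M] copies indep that
    by (auto simp: indep_vars_def measurable_cong_sets[OF refl sets_borel_eq_count_space])
  show "\<P>(\<omega> in M. \<forall>p\<in>S. a p \<le> (MIN k\<in>K. G k p \<omega>)) = 1 / real (\<Prod>p\<in>S. p ^ a p) ^ card K"
    if "finite S" "\<And>p. p \<in> S \<Longrightarrow> prime p" for S a
    using copies that indep geometric by (rule prob_Min_geometric_ge)
qed (rule card_K)

subsection \<open>The gcd of a uniformly distributed lattice point\<close>

lemma (in prob_space) prob_uniform_on_finite_set:
  fixes Z :: "'a \<Rightarrow> 'c"
  assumes uniform: "distributed M (count_space \<Omega>) Z (\<lambda>x. ennreal (indicator H x / real (card H)))"
    and support: "finite H" "H \<subseteq> \<Omega>"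
  shows "\<P>(\<omega> in M. P (Z \<omega>)) = proportion {x \<in> H. P x} H"
proof -
  have measurable_Z: "Z \<in> measurable M (count_space \<Omega>)" using uniform by (rule distributed_measurable)
  have "{\<omega> \<in> space M. P (Z \<omega>)} = Z -` {x \<in> \<Omega>. P x} \<inter> space M"
    using measurable_space[OF measurable_Z] by auto
  then have "emeasure M {\<omega> \<in> space M. P (Z \<omega>)} =
      (\<integral>\<^sup>+x. ennreal (indicator H x / real (card H)) * indicator {x \<in> \<Omega>. P x} x \<partial>count_space \<Omega>)"
    using distributed_emeasure[OF uniform, of "{x \<in> \<Omega>. P x}"] by simp
  also have "\<dots> = (\<Sum>x\<in>{x \<in> H. P x}. ennreal (indicator H x / real (card H)) * indicator {x \<in> \<Omega>. P x} x)"
    using support by (intro nn_integral_count_space') (auto simp: indicator_def)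
  also have "\<dots> = (\<Sum>x\<in>{x \<in> H. P x}. ennreal (1 / real (card H)))"
    using support by (intro sum.cong) (auto simp: indicator_def)
  also have "\<dots> = ennreal (real (card {x \<in> H. P x}) / real (card H))"
    by (subst sum_ennreal) auto
  finally show ?thesis by (simp add: measure_def proportion_def)
qed

lemma measurable_Gcd_restrict:
  assumes "(\<lambda>\<omega>. \<lambda>k\<in>I. V k \<omega>) \<in> measurable M (count_space \<Omega>)"
  shows "(\<lambda>\<omega>. GCD k\<in>I. V k \<omega> :: nat) \<in> measurable M (count_space UNIV)"
proof -
  have "(\<lambda>\<omega>. GCD k\<in>I. (\<lambda>k\<in>I. V k \<omega>) k) \<in> measurable M (count_space UNIV)"
    by (rule measurable_compose[OF assms]) simp
  then show ?thesis by simp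
qed

lemma dvd_prob_convergence_Gcd_uniform:
  fixes V :: "'n \<Rightarrow> 'i \<Rightarrow> 'a \<Rightarrow> nat" and H :: "'n \<Rightarrow> ('i \<Rightarrow> nat) set"
  assumes down: "\<And>n. finite_down_set I (H n)" and card_I: "2 \<le> card I"
    and proportions: "\<And>d. 0 < d \<Longrightarrow>
      ((\<lambda>n. proportion (multiples d I (H n)) (H n)) \<longlongrightarrow> 1 / real d ^ card I) F"
    and uniform: "\<forall>\<^sub>F n in F. prob_space (N n) \<and>
      distributed (N n) (count_space (I \<rightarrow>\<^sub>E UNIV)) (\<lambda>\<omega>. \<lambda>k\<in>I. V n k \<omega>)
        (\<lambda>x. ennreal (indicator (H n) x / real (card (H n))))"
    and limit: "prob_space M" "Y \<in> measurable M (count_space UNIV)"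
      "\<And>d. 0 < d \<Longrightarrow> \<P>(\<omega> in M. d dvd Y \<omega>) = 1 / real d ^ card I"
  shows "dvd_prob_convergence F N (\<lambda>n \<omega>. GCD k\<in>I. V n k \<omega>) M Y (\<lambda>d. 1 / real d ^ card I)"
proof (intro dvd_prob_convergence.intro limit)
  have eventually_prob_dvd: "\<forall>\<^sub>F n in F. \<forall>d. \<P>(\<omega> in N n. d dvd (GCD k\<in>I. V n k \<omega>)) =
      proportion (multiples d I (H n)) (H n)"
    using uniform
  proof eventually_elim
    case (elim n)
    interpret N: prob_space "N n" using elim by simp
    interpret finite_down_set I "H n" by (rule down)
    have "\<P>(\<omega> in N n. \<forall>k\<in>I. d dvd (\<lambda>k\<in>I. V n k \<omega>) k) =
        proportion {x \<in> H n. \<forall>k\<in>I. d dvd x k} (H n)" for d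
      using subset_PiE by (intro N.prob_uniform_on_finite_set[OF conjunct2[OF elim] finite_points]) auto
    then show ?case by (simp add: multiples_def dvd_Gcd_iff)
  qed
  then have prob_dvd_eq: "\<forall>\<^sub>F n in F. \<P>(\<omega> in N n. d dvd (GCD k\<in>I. V n k \<omega>)) =
      proportion (multiples d I (H n)) (H n)" for d
    by eventually_elim simp
  show "\<forall>\<^sub>F n in F. prob_space (N n) \<and> (\<lambda>\<omega>. GCD k\<in>I. V n k \<omega>) \<in> measurable (N n) (count_space UNIV)"
    using uniform by eventually_elim (auto intro: measurable_Gcd_restrict distributed_measurable)
  show "((\<lambda>n. \<P>(\<omega> in N n. d dvd (GCD k\<in>I. V n k \<omega>))) \<longlongrightarrow> \<P>(\<omega> in M. d dvd Y \<omega>)) F" if "0 < d" for d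
    using proportions[OF that] by (simp add: limit that tendsto_cong[OF prob_dvd_eq])
  show "\<forall>\<^sub>F n in F. \<forall>d>0. \<P>(\<omega> in N n. d dvd (GCD k\<in>I. V n k \<omega>)) \<le> 1 / real d ^ card I"
    using eventually_prob_dvd
    by eventually_elim (simp add: finite_down_set.proportion_multiples_le[OF down])
qed (rule summable_inverse_power[OF card_I])

theorem theorem3p5:
  fixes r l :: nat
    and N :: "nat \<Rightarrow> 'a measure"
    and V :: "nat \<Rightarrow> nat \<Rightarrow> 'a \<Rightarrow> nat"
    and M :: "'b measure"
    and G :: "nat \<Rightarrow> nat \<Rightarrow> 'b \<Rightarrow> nat"
    and f :: "nat \<Rightarrow> complex"
  assumes "r \<ge> 2" and "1 \<le> l" and "l \<le> r"
    and "\<And>n. n \<ge> r choose l \<Longrightarrow> prob_space (N n)"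
    and "\<And>n. n \<ge> r choose l \<Longrightarrow>
           distributed (N n) (count_space ({1..r} \<rightarrow>\<^sub>E UNIV)) (\<lambda>\<omega>. \<lambda>k\<in>{1..r}. V n k \<omega>)
             (\<lambda>x. ennreal (indicator (hyperbolic_region l r n) x
                            / real (card (hyperbolic_region l r n))))"
    and "prob_space M"
    and "prob_space.indep_vars M (\<lambda>_. count_space UNIV) (\<lambda>(k, p). G k p) ({1..} \<times> {p. prime p})"
    and "\<And>k p j. k \<ge> 1 \<Longrightarrow> prime p \<Longrightarrow>
           measure M {\<omega> \<in> space M. G k p \<omega> = j} = (1 - 1 / real p) * (1 / real p) ^ j"
  shows "converges_in_distribution
           N (\<lambda>n \<omega>. f (GCD k\<in>{1..r}. V n k \<omega>))
           M (\<lambda>\<omega>. f (\<Prod>p. if prime p then p ^ (MIN k\<in>{1..r}. G k p \<omega>) else 1))"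
proof -
  interpret prob_space M by fact
  have "indep_vars (\<lambda>_. count_space UNIV) (\<lambda>(k, p). G k p) ({1..r} \<times> {p. prime p})"
    by (rule indep_vars_subset[OF assms(7)]) auto
  then have "zeta_prime_exponents M (\<lambda>p \<omega>. MIN k\<in>{1..r}. G k p \<omega>) (card {1..r})"
    using assms by (intro zeta_prime_exponents_Min_geometric) auto
  then interpret zeta_prime_exponents M "\<lambda>p \<omega>. MIN k\<in>{1..r}. G k p \<omega>" "card {1..r}" .
  have "dvd_prob_convergence sequentially N (\<lambda>n \<omega>. GCD k\<in>{1..r}. V n k \<omega>)
      M (\<lambda>\<omega>. prime_power_prod (\<lambda>p. MIN k\<in>{1..r}. G k p \<omega>)) (\<lambda>d. 1 / real d ^ card {1..r})"
  proof (rule dvd_prob_convergence_Gcd_uniform)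
    show "finite_down_set {1..r} (hyperbolic_region l r n)" for n
      using transfer_closed_hyperbolic_region[OF assms(2,3)] by (rule transfer_closed_down_set.axioms)
    show "\<forall>\<^sub>F n in sequentially. prob_space (N n) \<and>
        distributed (N n) (count_space ({1..r} \<rightarrow>\<^sub>E UNIV)) (\<lambda>\<omega>. \<lambda>k\<in>{1..r}. V n k \<omega>)
          (\<lambda>x. ennreal (indicator (hyperbolic_region l r n) x / real (card (hyperbolic_region l r n))))"
      using assms(4,5) by (intro eventually_sequentiallyI[of "r choose l"] conjI)
  qed (use assms tendsto_proportion_multiples_hyperbolic_region measurable_prime_power_prod_exponents prob_dvd_prime_power_prod in auto)
  then show ?thesis
    unfolding prime_power_prod_def by (rule converges_in_distribution_of_dvd_prob_convergence)
qed

end
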